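(* Let $e$ be a central element of a Łukasiewicz near semiring $\mathbf A$. Then the least ideal $I(e)$ containing $e$ equals the interval $[0,e]=\{x\in A: x\le e\}$.
   Context: An $\iota$-near semiring is an algebra $\mathbf A=\langle A,+,\cdot,{}^{\alpha},0,1\rangle$ of type $\langle 2,2,1,0,0\rangle$ such that $\langle A,+\rangle$ is a join semilattice with least element $0$ and greatest element $1$ (order $x\le y$ iff $x+y=y$), $x\cdot1=x=1\cdot x$, $(x+y)\cdot z=xz+yz$, $x0=0x=0$, $(x^{\alpha})^{\alpha}=x$, and $x\le y$ implies $y^{\alpha}\le x^{\alpha}$. A Łukasiewicz near semiring is an $\iota$-near semiring satisfying $(x y^{\alpha})^{\alpha} y^{\alpha}=(y x^{\alpha})^{\alpha} x^{\alpha}$. Juxtaposition $xy$ denotes $x\cdot y$. An ideal of $\mathbf A$ is a set $I\subseteq A$ with $0\in I$ such that (I1) if $ab^{\alpha}\in I$ and $b\in I$ then $a\in I$; (I2) if $a^{\alpha}b\in I$ and $b^{\alpha}a\in I$ then $(ac)^{\alpha}(bc)\in I$ and $(ca)^{\alpha}(cb)\in I$ for every $c\in A$. An element $e\in A$ is central if the principal congruences $\theta(e,0)$ and $\theta(e,1)$ form a pair of factor congruences: $\theta(e,0)\cap\theta(e,1)$ is the identity relation and $\theta(e,0)\circ\theta(e,1)=A\times A$. *)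

theory Defs
  imports "HOL-Algebra.Ring"
begin

record 'a near_semiring_alg = "'a ring" +
  invol :: "'a \<Rightarrow> 'a" (\<open>(_\<^sup>\<alpha>\<index>)\<close> [1000] 999)

definition nsr_le :: "('a, 'm) near_semiring_alg_scheme \<Rightarrow> 'a \<Rightarrow> 'a \<Rightarrow> bool" (infix \<open>\<preceq>\<index>\<close> 50)
  where "x \<preceq>\<^bsub>A\<^esub> y \<longleftrightarrow> x \<oplus>\<^bsub>A\<^esub> y = y"

text \<open>Multiplication is neither associative nor commutative in general, and distributivity is
  required on one side only; hence the library locales for semirings are not applicable.\<close>

locale iota_near_semiring =
  fixes A :: "('a, 'm) near_semiring_alg_scheme" (structure)
  assumes zero_closed: "\<zero> \<in> carrier A"
    and one_closed: "\<one> \<in> carrier A"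
    and add_closed: "\<lbrakk>x \<in> carrier A; y \<in> carrier A\<rbrakk> \<Longrightarrow> x \<oplus> y \<in> carrier A"
    and mult_closed: "\<lbrakk>x \<in> carrier A; y \<in> carrier A\<rbrakk> \<Longrightarrow> x \<otimes> y \<in> carrier A"
    and invol_closed: "x \<in> carrier A \<Longrightarrow> x\<^sup>\<alpha> \<in> carrier A"
    and add_assoc: "\<lbrakk>x \<in> carrier A; y \<in> carrier A; z \<in> carrier A\<rbrakk>
      \<Longrightarrow> (x \<oplus> y) \<oplus> z = x \<oplus> (y \<oplus> z)"
    and add_comm: "\<lbrakk>x \<in> carrier A; y \<in> carrier A\<rbrakk> \<Longrightarrow> x \<oplus> y = y \<oplus> x"
    and add_idem: "x \<in> carrier A \<Longrightarrow> x \<oplus> x = x"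
    and zero_least: "x \<in> carrier A \<Longrightarrow> \<zero> \<preceq> x"
    and one_greatest: "x \<in> carrier A \<Longrightarrow> x \<preceq> \<one>"
    and mult_one_right: "x \<in> carrier A \<Longrightarrow> x \<otimes> \<one> = x"
    and mult_one_left: "x \<in> carrier A \<Longrightarrow> \<one> \<otimes> x = x"
    and distrib_right: "\<lbrakk>x \<in> carrier A; y \<in> carrier A; z \<in> carrier A\<rbrakk>
      \<Longrightarrow> (x \<oplus> y) \<otimes> z = (x \<otimes> z) \<oplus> (y \<otimes> z)"
    and mult_zero_right: "x \<in> carrier A \<Longrightarrow> x \<otimes> \<zero> = \<zero>"
    and mult_zero_left: "x \<in> carrier A \<Longrightarrow> \<zero> \<otimes> x = \<zero>"
    and invol_invol: "x \<in> carrier A \<Longrightarrow> (x\<^sup>\<alpha>)\<^sup>\<alpha> = x"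
    and invol_antitone: "\<lbrakk>x \<in> carrier A; y \<in> carrier A; x \<preceq> y\<rbrakk> \<Longrightarrow> y\<^sup>\<alpha> \<preceq> x\<^sup>\<alpha>"

locale lukasiewicz_near_semiring = iota_near_semiring +
  assumes lukasiewicz: "\<lbrakk>x \<in> carrier A; y \<in> carrier A\<rbrakk>
      \<Longrightarrow> (x \<otimes> y\<^sup>\<alpha>)\<^sup>\<alpha> \<otimes> y\<^sup>\<alpha> = (y \<otimes> x\<^sup>\<alpha>)\<^sup>\<alpha> \<otimes> x\<^sup>\<alpha>"

definition nsr_ideal :: "('a, 'm) near_semiring_alg_scheme \<Rightarrow> 'a set \<Rightarrow> bool" where
  "nsr_ideal A I \<longleftrightarrow>
     I \<subseteq> carrier A \<and>
     \<zero>\<^bsub>A\<^esub> \<in> I \<and>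
     (\<forall>a \<in> carrier A. \<forall>b \<in> carrier A. a \<otimes>\<^bsub>A\<^esub> b\<^sup>\<alpha>\<^bsub>A\<^esub> \<in> I \<and> b \<in> I \<longrightarrow> a \<in> I) \<and>
     (\<forall>a \<in> carrier A. \<forall>b \<in> carrier A.
        a\<^sup>\<alpha>\<^bsub>A\<^esub> \<otimes>\<^bsub>A\<^esub> b \<in> I \<and> b\<^sup>\<alpha>\<^bsub>A\<^esub> \<otimes>\<^bsub>A\<^esub> a \<in> I \<longrightarrow>
        (\<forall>c \<in> carrier A.
           (a \<otimes>\<^bsub>A\<^esub> c)\<^sup>\<alpha>\<^bsub>A\<^esub> \<otimes>\<^bsub>A\<^esub> (b \<otimes>\<^bsub>A\<^esub> c) \<in> I \<and>
           (c \<otimes>\<^bsub>A\<^esub> a)\<^sup>\<alpha>\<^bsub>A\<^esub> \<otimes>\<^bsub>A\<^esub> (c \<otimes>\<^bsub>A\<^esub> b) \<in> I))"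

definition least_nsr_ideal :: "('a, 'm) near_semiring_alg_scheme \<Rightarrow> 'a \<Rightarrow> 'a set" where
  "least_nsr_ideal A e = (LEAST I. nsr_ideal A I \<and> e \<in> I)"

definition nsr_congruence :: "('a, 'm) near_semiring_alg_scheme \<Rightarrow> ('a \<times> 'a) set \<Rightarrow> bool" where
  "nsr_congruence A R \<longleftrightarrow>
     equiv (carrier A) R \<and>
     (\<forall>a b c d. (a, b) \<in> R \<and> (c, d) \<in> R \<longrightarrow> (a \<oplus>\<^bsub>A\<^esub> c, b \<oplus>\<^bsub>A\<^esub> d) \<in> R) \<and>
     (\<forall>a b c d. (a, b) \<in> R \<and> (c, d) \<in> R \<longrightarrow> (a \<otimes>\<^bsub>A\<^esub> c, b \<otimes>\<^bsub>A\<^esub> d) \<in> R) \<and>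
     (\<forall>a b. (a, b) \<in> R \<longrightarrow> (a\<^sup>\<alpha>\<^bsub>A\<^esub>, b\<^sup>\<alpha>\<^bsub>A\<^esub>) \<in> R)"

definition principal_congruence ::
    "('a, 'm) near_semiring_alg_scheme \<Rightarrow> 'a \<Rightarrow> 'a \<Rightarrow> ('a \<times> 'a) set" where
  "principal_congruence A a b = \<Inter> {R. nsr_congruence A R \<and> (a, b) \<in> R}"

definition factor_congruences ::
    "('a, 'm) near_semiring_alg_scheme \<Rightarrow> ('a \<times> 'a) set \<Rightarrow> ('a \<times> 'a) set \<Rightarrow> bool" where
  "factor_congruences A R S \<longleftrightarrow>
     nsr_congruence A R \<and> nsr_congruence A S \<and>
     R \<inter> S = Id_on (carrier A) \<and> R O S = carrier A \<times> carrier A"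

definition nsr_central :: "('a, 'm) near_semiring_alg_scheme \<Rightarrow> 'a \<Rightarrow> bool" where
  "nsr_central A e \<longleftrightarrow>
     e \<in> carrier A \<and>
     factor_congruences A (principal_congruence A e \<zero>\<^bsub>A\<^esub>) (principal_congruence A e \<one>\<^bsub>A\<^esub>)"

definition nsr_interval :: "('a, 'm) near_semiring_alg_scheme \<Rightarrow> 'a \<Rightarrow> 'a \<Rightarrow> 'a set" where
  "nsr_interval A a b = {x \<in> carrier A. a \<preceq>\<^bsub>A\<^esub> x \<and> x \<preceq>\<^bsub>A\<^esub> b}"

text \<open>The least ideal containing a given element exists, so the description operator in
  \<^const>\<open>least_nsr_ideal\<close> is well-defined; likewise \<^const>\<open>principal_congruence\<close> is a congruence.\<close>

lemma (in iota_near_semiring) nsr_ideal_Inter: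
  assumes ne: "\<I> \<noteq> {}" and id: "\<And>I. I \<in> \<I> \<Longrightarrow> nsr_ideal A I"
  shows "nsr_ideal A (\<Inter> \<I>)"
  unfolding nsr_ideal_def
proof (intro conjI ballI impI)
  show "\<Inter> \<I> \<subseteq> carrier A"
    using ne id unfolding nsr_ideal_def by blast
  show "\<zero> \<in> \<Inter> \<I>"
    using id unfolding nsr_ideal_def by blast
next
  fix a b
  assume ab: "a \<in> carrier A" "b \<in> carrier A" "a \<otimes> b\<^sup>\<alpha> \<in> \<Inter> \<I> \<and> b \<in> \<Inter> \<I>"
  show "a \<in> \<Inter> \<I>"
  proof
    fix I assume I: "I \<in> \<I>"
    then have "a \<otimes> b\<^sup>\<alpha> \<in> I" "b \<in> I" using ab by auto
    with ab(1,2) id[OF I] show "a \<in> I" unfolding nsr_ideal_def by blast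
  qed
next
  fix a b c
  assume abc: "a \<in> carrier A" "b \<in> carrier A" "c \<in> carrier A"
    "a\<^sup>\<alpha> \<otimes> b \<in> \<Inter> \<I> \<and> b\<^sup>\<alpha> \<otimes> a \<in> \<Inter> \<I>"
  have *: "(a \<otimes> c)\<^sup>\<alpha> \<otimes> (b \<otimes> c) \<in> I \<and> (c \<otimes> a)\<^sup>\<alpha> \<otimes> (c \<otimes> b) \<in> I" if I: "I \<in> \<I>" for I
  proof -
    have "a\<^sup>\<alpha> \<otimes> b \<in> I" "b\<^sup>\<alpha> \<otimes> a \<in> I" using I abc by auto
    with abc(1-3) id[OF I] show ?thesis unfolding nsr_ideal_def by blast
  qed
  show "(a \<otimes> c)\<^sup>\<alpha> \<otimes> (b \<otimes> c) \<in> \<Inter> \<I>" using * by simp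
  show "(c \<otimes> a)\<^sup>\<alpha> \<otimes> (c \<otimes> b) \<in> \<Inter> \<I>" using * by simp
qed

lemma (in iota_near_semiring) least_nsr_ideal_eq_Inter:
  assumes "e \<in> carrier A"
  shows "least_nsr_ideal A e = \<Inter> {I. nsr_ideal A I \<and> e \<in> I}"
    and "nsr_ideal A (least_nsr_ideal A e)"
proof -
  have top: "nsr_ideal A (carrier A)"
    unfolding nsr_ideal_def by (simp add: zero_closed mult_closed invol_closed)
  let ?M = "\<Inter> {I. nsr_ideal A I \<and> e \<in> I}"
  have id: "nsr_ideal A ?M"
    by (rule nsr_ideal_Inter) (use top assms in blast)+
  show eq: "least_nsr_ideal A e = ?M"
    unfolding least_nsr_ideal_def by (rule Least_equality) (use id in blast)+
  show "nsr_ideal A (least_nsr_ideal A e)"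
    using id eq by simp
qed

lemma (in iota_near_semiring) principal_congruence_congruence:
  assumes "a \<in> carrier A" "b \<in> carrier A"
  shows "nsr_congruence A (principal_congruence A a b)"
proof -
  let ?P = "principal_congruence A a b"
  have top: "nsr_congruence A (carrier A \<times> carrier A)"
    unfolding nsr_congruence_def equiv_def refl_on_def sym_def trans_def
    by (simp add: add_closed mult_closed invol_closed)
  have sub: "?P \<subseteq> carrier A \<times> carrier A"
    using top assms unfolding principal_congruence_def by blast
  have mem: "p \<in> ?P \<longleftrightarrow> (\<forall>R. nsr_congruence A R \<and> (a, b) \<in> R \<longrightarrow> p \<in> R)" for p
    unfolding principal_congruence_def by blast
  have "refl_on (carrier A) ?P"
    unfolding refl_on_def mem by (simp add: nsr_congruence_def equiv_def refl_on_def)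
  moreover have "sym ?P"
    unfolding sym_def mem by (meson nsr_congruence_def equiv_def symD)
  moreover have "trans ?P"
    unfolding trans_def mem by (meson nsr_congruence_def equiv_def transD)
  ultimately have "equiv (carrier A) ?P"
    using sub by (intro equivI)
  then show ?thesis
    unfolding nsr_congruence_def[of A ?P] mem by (simp add: nsr_congruence_def)
qed

end

theory Submission
  imports Defs
begin

text \<open>Write \<open>\<theta>\<close> for the congruence generated by \<open>(e, 0)\<close> and \<open>\<psi>\<close> for the one generated by
  \<open>(e, 1)\<close>. The class of \<open>0\<close> of any congruence is an ideal, because the Lukasiewicz identity at
  \<open>a\<^sup>\<alpha>, b\<^sup>\<alpha>\<close> makes \<open>a\<close> and \<open>b\<close> congruent as soon as \<open>a\<^sup>\<alpha>b\<close> and \<open>b\<^sup>\<alpha>a\<close> are congruent to \<open>0\<close>.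
  For \<open>x\<close> in the \<open>\<theta>\<close>-class of \<open>0\<close>, the elements \<open>x + e\<close> and \<open>e\<close> are congruent modulo both \<open>\<theta>\<close>
  and \<open>\<psi>\<close>, so \<open>x \<le> e\<close>; thus \<open>[0, e]\<close> is that class. Conversely \<open>x \<le> e\<close> gives
  \<open>x e\<^sup>\<alpha> \<le> e e\<^sup>\<alpha> = 0\<close>, which puts \<open>x\<close> into every ideal containing \<open>e\<close>.\<close>

context iota_near_semiring
begin

lemma add_zero_right: "x \<in> carrier A \<Longrightarrow> x \<oplus> \<zero> = x"
  using zero_least add_comm zero_closed by (metis nsr_le_def)

lemma add_one_right: "x \<in> carrier A \<Longrightarrow> x \<oplus> \<one> = \<one>"
  using one_greatest by (simp add: nsr_le_def)

text \<open>Antitonicity turns \<open>\<zero> \<preceq> \<one>\<^sup>\<alpha>\<close> into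
  \<open>\<one> \<preceq> \<zero>\<^sup>\<alpha>\<close>.\<close>

lemma invol_zero: "\<zero>\<^sup>\<alpha> = \<one>"
proof -
  have "\<one> \<preceq> \<zero>\<^sup>\<alpha>"
    using invol_antitone[OF zero_closed invol_closed[OF one_closed] zero_least]
    by (simp add: invol_invol invol_closed one_closed)
  then show ?thesis
    using one_greatest[OF invol_closed[OF zero_closed]]
      add_comm[OF one_closed invol_closed[OF zero_closed]]
    by (simp add: nsr_le_def)
qed

lemma invol_one: "\<one>\<^sup>\<alpha> = \<zero>"
  using invol_invol[OF zero_closed] by (simp add: invol_zero)

text \<open>Adding \<open>x\<close> to both sides of e ~ 0 gives e = x + e ~ x, and e ~ 0.\<close>

lemma le_imp_congruent_zero:
  assumes R: "nsr_congruence A R" and e: "(e, \<zero>) \<in> R" and x: "x \<in> carrier A" and le: "x \<preceq> e"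
  shows "(x, \<zero>) \<in> R"
proof -
  have eq: "equiv (carrier A) R" using R by (simp add: nsr_congruence_def)
  have "(x, x) \<in> R" using eq x by (simp add: equiv_def refl_on_def)
  then have "(x \<oplus> e, x \<oplus> \<zero>) \<in> R" using R e unfolding nsr_congruence_def by blast
  then have "(e, x) \<in> R" using le x by (simp add: nsr_le_def add_zero_right)
  then show ?thesis using eq e unfolding equiv_def by (meson symD transD)
qed

lemma congruent_zero_imp_le:
  assumes R: "nsr_congruence A R" and S: "nsr_congruence A S" and RS: "R \<inter> S = Id_on (carrier A)"
    and eR: "(e, \<zero>) \<in> R" and eS: "(e, \<one>) \<in> S"
    and e: "e \<in> carrier A" and x: "x \<in> carrier A" and xR: "(x, \<zero>) \<in> R"
  shows "x \<preceq> e"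
proof -
  have eqR: "equiv (carrier A) R" and eqS: "equiv (carrier A) S"
    using R S by (simp_all add: nsr_congruence_def)
  have "(x \<oplus> e, \<zero> \<oplus> \<zero>) \<in> R" using R xR eR unfolding nsr_congruence_def by blast
  then have "(x \<oplus> e, \<zero>) \<in> R" by (simp add: add_idem zero_closed)
  then have 1: "(x \<oplus> e, e) \<in> R" using eqR eR unfolding equiv_def by (meson symD transD)
  have "(x, x) \<in> S" using eqS x by (simp add: equiv_def refl_on_def)
  \<comment> \<open>Modulo \<open>S\<close>, \<open>e\<close> becomes the top element, which absorbs
    \<open>x\<close>.\<close>
  then have "(x \<oplus> e, x \<oplus> \<one>) \<in> S" using S eS unfolding nsr_congruence_def by blast
  then have "(x \<oplus> e, \<one>) \<in> S" by (simp add: add_one_right x)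
  then have 2: "(x \<oplus> e, e) \<in> S" using eqS eS unfolding equiv_def by (meson symD transD)
  from 1 2 RS have "(x \<oplus> e, e) \<in> Id_on (carrier A)" by blast
  then show ?thesis by (simp add: nsr_le_def Id_on_iff)
qed

end

context lukasiewicz_near_semiring
begin

text \<open>In the Lukasiewicz identity at 1 and \<open>x\<close>, the right side has the factor
  \<open>\<one>\<^sup>\<alpha>\<close> = 0, while the left side reduces to
  \<open>x \<otimes> x\<^sup>\<alpha>\<close>.\<close>

lemma mult_invol_self: "x \<in> carrier A \<Longrightarrow> x \<otimes> x\<^sup>\<alpha> = \<zero>"
  using lukasiewicz[OF one_closed, of x]
  by (simp add: invol_one mult_one_left mult_zero_right invol_closed invol_invol mult_closed
      zero_closed)

lemma invol_mult_self: "x \<in> carrier A \<Longrightarrow> x\<^sup>\<alpha> \<otimes> x = \<zero>"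
  using mult_invol_self[OF invol_closed, of x] by (simp add: invol_invol)

text \<open>Right distributivity makes multiplication monotone in its left factor, so the product
  lies below \<open>y \<otimes> y\<^sup>\<alpha>\<close> = 0.\<close>

lemma mult_invol_eq_zero:
  assumes "x \<in> carrier A" "y \<in> carrier A" "x \<preceq> y"
  shows "x \<otimes> y\<^sup>\<alpha> = \<zero>"
proof -
  have "x \<otimes> y\<^sup>\<alpha> \<oplus> y \<otimes> y\<^sup>\<alpha> = y \<otimes> y\<^sup>\<alpha>"
    using assms distrib_right[of x y "y\<^sup>\<alpha>"] by (simp add: nsr_le_def invol_closed)
  then show ?thesis
    using assms by (simp add: mult_invol_self add_zero_right mult_closed invol_closed)
qed

lemma congruence_zero_class_ideal:
  assumes R: "nsr_congruence A R"
  shows "nsr_ideal A {x \<in> carrier A. (x, \<zero>) \<in> R}"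
proof -
  have eq: "equiv (carrier A) R" using R by (simp add: nsr_congruence_def)
  have refl: "(x, x) \<in> R" if "x \<in> carrier A" for x
    using eq that by (simp add: equiv_def refl_on_def)
  have sym: "(x, y) \<in> R \<Longrightarrow> (y, x) \<in> R" for x y
    using eq unfolding equiv_def by (meson symD)
  have trans: "(x, y) \<in> R \<Longrightarrow> (y, z) \<in> R \<Longrightarrow> (x, z) \<in> R" for x y z
    using eq unfolding equiv_def by (meson transD)
  have mult: "(a, b) \<in> R \<Longrightarrow> (c, d) \<in> R \<Longrightarrow> (a \<otimes> c, b \<otimes> d) \<in> R" for a b c d
    using R unfolding nsr_congruence_def by blast
  have invol: "(a, b) \<in> R \<Longrightarrow> (a\<^sup>\<alpha>, b\<^sup>\<alpha>) \<in> R" for a b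
    using R unfolding nsr_congruence_def by blast
  \<comment> \<open>If x ~ 0, then \<open>x\<^sup>\<alpha>\<close> ~ 1 acts as a left unit modulo
    \<open>R\<close>.\<close>
  have zero_mult: "((x\<^sup>\<alpha>) \<otimes> y, y) \<in> R" if "(x, \<zero>) \<in> R" "y \<in> carrier A" for x y
    using mult[OF invol[OF that(1)] refl[OF that(2)]] that(2)
    by (simp add: invol_zero mult_one_left)
  have I1: "(a, \<zero>) \<in> R"
    if "a \<in> carrier A" "(a \<otimes> b\<^sup>\<alpha>, \<zero>) \<in> R" "(b, \<zero>) \<in> R" for a b
  proof -
    have "(a \<otimes> b\<^sup>\<alpha>, a) \<in> R"
      using mult[OF refl[OF that(1)] invol[OF that(3)]] that(1)
      by (simp add: invol_zero mult_one_right)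
    then show ?thesis using that(2) sym trans by blast
  qed
  \<comment> \<open>Here \<open>a\<^sup>\<alpha> \<otimes> b\<close> ~
    \<open>b\<^sup>\<alpha> \<otimes> b\<close> = 0; this is the converse of \<open>eqv\<close>
    below.\<close>
  have diff: "(a\<^sup>\<alpha> \<otimes> b, \<zero>) \<in> R" if "(a, b) \<in> R" "b \<in> carrier A" for a b
    using mult[OF invol[OF that(1)] refl[OF that(2)]] that(2) by (simp add: invol_mult_self)
  have eqv: "(a, b) \<in> R"
    if "a \<in> carrier A" "b \<in> carrier A" "(a\<^sup>\<alpha> \<otimes> b, \<zero>) \<in> R" "(b\<^sup>\<alpha> \<otimes> a, \<zero>) \<in> R" for a b
  proof -
    have "(a\<^sup>\<alpha> \<otimes> b)\<^sup>\<alpha> \<otimes> b = (b\<^sup>\<alpha> \<otimes> a)\<^sup>\<alpha> \<otimes> a"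
      using lukasiewicz[OF invol_closed invol_closed, of a b] that(1,2) by (simp add: invol_invol)
    \<comment> \<open>By \<open>zero_mult\<close> the left side of the identity is congruent to
      \<open>b\<close> and the right side to \<open>a\<close>.\<close>
    then show ?thesis
      using zero_mult[OF that(3,2)] zero_mult[OF that(4,1)] sym trans by metis
  qed
  have I2: "((a \<otimes> c)\<^sup>\<alpha> \<otimes> (b \<otimes> c), \<zero>) \<in> R \<and> ((c \<otimes> a)\<^sup>\<alpha> \<otimes> (c \<otimes> b), \<zero>) \<in> R"
    if "a \<in> carrier A" "b \<in> carrier A" "c \<in> carrier A"
      "(a\<^sup>\<alpha> \<otimes> b, \<zero>) \<in> R" "(b\<^sup>\<alpha> \<otimes> a, \<zero>) \<in> R" for a b c
    \<comment> \<open>Pass to a ~ b, multiply by \<open>c\<close> on either side, and return with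
      \<open>diff\<close>.\<close>
    using that eqv[of a b] by (simp add: diff mult refl mult_closed)
  show ?thesis
    unfolding nsr_ideal_def using I1 I2
    by (auto simp: zero_closed refl mult_closed invol_closed)
qed

lemma le_mem_ideal:
  assumes "nsr_ideal A I" "e \<in> I" "x \<in> carrier A" "x \<preceq> e"
  shows "x \<in> I"
proof -
  have "e \<in> carrier A" using assms by (auto simp: nsr_ideal_def)
  moreover from this have "x \<otimes> e\<^sup>\<alpha> \<in> I"
    using assms by (simp add: mult_invol_eq_zero nsr_ideal_def)
  ultimately show ?thesis using assms unfolding nsr_ideal_def by blast
qed

end

theorem theorem9:
  fixes A :: "('a, 'm) near_semiring_alg_scheme" and e :: 'a
  assumes "lukasiewicz_near_semiring A"
    and "nsr_central A e"
  shows "least_nsr_ideal A e = nsr_interval A \<zero>\<^bsub>A\<^esub> e"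
proof -
  interpret lukasiewicz_near_semiring A by fact
  let ?R = "principal_congruence A e \<zero>\<^bsub>A\<^esub>" and ?S = "principal_congruence A e \<one>\<^bsub>A\<^esub>"
  have e: "e \<in> carrier A" and R: "nsr_congruence A ?R" and S: "nsr_congruence A ?S"
    and RS: "?R \<inter> ?S = Id_on (carrier A)"
    using assms(2) by (auto simp: nsr_central_def factor_congruences_def)
  have eR: "(e, \<zero>\<^bsub>A\<^esub>) \<in> ?R" and eS: "(e, \<one>\<^bsub>A\<^esub>) \<in> ?S"
    by (auto simp: principal_congruence_def)
  have "nsr_interval A \<zero>\<^bsub>A\<^esub> e = {x \<in> carrier A. (x, \<zero>\<^bsub>A\<^esub>) \<in> ?R}"
    using le_imp_congruent_zero[OF R eR] congruent_zero_imp_le[OF R S RS eR eS e]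
    by (auto simp: nsr_interval_def zero_least)
  then have "nsr_ideal A (nsr_interval A \<zero>\<^bsub>A\<^esub> e)"
    using congruence_zero_class_ideal[OF R] by simp
  moreover have "e \<in> nsr_interval A \<zero>\<^bsub>A\<^esub> e"
    using e by (simp add: nsr_interval_def zero_least nsr_le_def[of A e e] add_idem)
  moreover have "nsr_interval A \<zero>\<^bsub>A\<^esub> e \<subseteq> I" if "nsr_ideal A I" "e \<in> I" for I
    using le_mem_ideal[OF that] by (auto simp: nsr_interval_def)
  \<comment> \<open>The interval is a member of the family of ideals containing \<open>e\<close> and
    lies inside every other member, so it is their intersection.\<close>
  ultimately show ?thesis
    unfolding least_nsr_ideal_eq_Inter(1)[OF e] by blast
qed

end
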